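(* Let $\lambda\in\mathbb{C}^*$, $\alpha\in\mathbb{C}$, let $h$ be a polynomial in one variable over $\mathbb{C}$, and let $M=\mathbb{C}[t,s]\oplus\mathbb{C}[y,x]$ be the $\mathbb{Z}_2$-graded vector space with $M_{\bar 0}=\mathbb{C}[t,s]$ and $M_{\bar 1}=\mathbb{C}[y,x]$. For $m\in\mathbb{Z}$, $r\in\frac12+\mathbb{Z}$, $i=1,2$, $f(t,s)\in\mathbb{C}[t,s]$ and $k(y,x)\in\mathbb{C}[y,x]$ define $$L_mf(t,s)=\lambda^m(s+h_m(t))f(t,s-m)-m\lambda^m(t-m\alpha)\frac{\partial}{\partial t}(f(t,s-m)),$$ $$L_mk(y,x)=\lambda^m\Big(x-\frac m2+h_m(y)\Big)k(y,x-m)-m\lambda^m(y-m\alpha)\frac{\partial}{\partial y}k(y,x-m),$$ $$W_mf(t,s)=\lambda^m(t-m\alpha)f(t,s-m),\qquad W_mk(y,x)=\lambda^m(y-m\alpha)k(y,x-m),$$ $$G_rf(t,s)=\lambda^{r-\frac12}f(y,x-r),\qquad G_rk(y,x)=\lambda^{r+\frac12}(t-2r\alpha)k(t,s-r),$$ $$C_i(f(t,s))=C_i(k(y,x))=0.$$ Then $M$ is an $\mathfrak{S}^{\frac12}$-module under this action, and it is free of rank $2$ as a module over $U(\mathfrak{T})=\mathbb{C}[L_0,W_0]$, where $\mathfrak{T}=\mathbb{C}L_0\oplus\mathbb{C}W_0$.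
   Context: All vector spaces are over $\mathbb{C}$. The Neveu-Schwarz type super-BMS$_3$ algebra $\mathfrak{S}^{\frac12}$ is the Lie superalgebra with basis $\{L_m,W_m,G_r,C_1,C_2\mid m\in\mathbb{Z},r\in\frac12+\mathbb{Z}\}$, where $L_m,W_m,C_1,C_2$ are even, the $G_r$ are odd, $C_1,C_2$ are central, and the non-trivial brackets are $$[L_m,L_n]=(n-m)L_{m+n}+\tfrac{n^3-n}{12}\delta_{m+n,0}C_1,\quad [L_m,W_n]=(n-m)W_{m+n}+\tfrac{n^3-n}{12}\delta_{m+n,0}C_2,$$ $$[L_m,G_r]=(r-\tfrac m2)G_{m+r},\quad [G_r,G_s]=2W_{r+s}+\tfrac13(r^2-\tfrac14)\delta_{r+s,0}C_2$$ (so $[W_m,W_n]=0$ and $[W_m,G_r]=0$). A module over a Lie superalgebra $\mathcal{G}$ is a $\mathbb{Z}_2$-graded vector space $V$ with a bilinear action satisfying $x(yv)-(-1)^{|x||y|}y(xv)=[x,y]v$ for homogeneous $x,y$, and $\mathcal{G}_{\bar i}V_{\bar j}\subseteq V_{\bar i+\bar j}$. For a polynomial $h$, $\alpha\in\mathbb{C}$ and $m\in\mathbb{Z}$, $h_m(t)=m\,h(t)-m(m-1)\alpha\,\frac{h(t)-h(\alpha)}{t-\alpha}\in\mathbb{C}[t]$, and $h_m(y)$ is the same polynomial in the variable $y$. In the formulas for $G_r$, $f(y,x-r)$ denotes the element of $\mathbb{C}[y,x]$ obtained from $f(t,s)$ by the substitution $t\mapsto y$, $s\mapsto x-r$, and $k(t,s-r)$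 denotes the element of $\mathbb{C}[t,s]$ obtained from $k(y,x)$ by $y\mapsto t$, $x\mapsto s-r$. *)

theory Defs
  imports
    Complex_Main
    "HOL-Library.Z2"
    "HOL-Library.Product_Plus"
    "HOL-Library.Poly_Mapping"
    "HOL-Computational_Algebra.Polynomial"
begin

section \<open>Lie superalgebras and their modules\<close>

text \<open>Complex vector spaces graded by \<open>\<int>\<^sub>2\<close>, which is the two-element field \<^typ>\<open>bit\<close>.\<close>

locale super_vector_space = vector_space scale
  for scale :: "complex \<Rightarrow> 'v::ab_group_add \<Rightarrow> 'v" +
  fixes part :: "bit \<Rightarrow> 'v set"
  assumes subspace_part: "module.subspace scale (part i)"
    and part_sum: "\<exists>a\<in>part 0. \<exists>b\<in>part 1. v = a + b"
    and part_direct: "part 0 \<inter> part 1 = {0}"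

definition koszul_sign :: "bit \<Rightarrow> bit \<Rightarrow> complex" where
  "koszul_sign i j = (if i = 1 \<and> j = 1 then - 1 else 1)"

locale lie_superalgebra = super_vector_space scale part
  for scale :: "complex \<Rightarrow> 'g::ab_group_add \<Rightarrow> 'g" and part :: "bit \<Rightarrow> 'g set" +
  fixes bracket :: "'g \<Rightarrow> 'g \<Rightarrow> 'g"
  assumes bracket_linear_left: "Vector_Spaces.linear scale scale (\<lambda>x. bracket x y)"
    and bracket_linear_right: "Vector_Spaces.linear scale scale (bracket x)"
    and bracket_part: "x \<in> part i \<Longrightarrow> y \<in> part j \<Longrightarrow> bracket x y \<in> part (i + j)"
    and bracket_skew: "x \<in> part i \<Longrightarrow> y \<in> part j \<Longrightarrow>
      bracket x y = - scale (koszul_sign i j) (bracket y x)"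
    and bracket_jacobi: "x \<in> part i \<Longrightarrow> y \<in> part j \<Longrightarrow> z \<in> part k \<Longrightarrow>
      bracket x (bracket y z) =
        bracket (bracket x y) z + scale (koszul_sign i j) (bracket y (bracket x z))"

locale lie_superalgebra_module =
  G: lie_superalgebra scaleG partG bracket + V: super_vector_space scaleV partV
  for scaleG :: "complex \<Rightarrow> 'g::ab_group_add \<Rightarrow> 'g" and partG :: "bit \<Rightarrow> 'g set"
    and bracket :: "'g \<Rightarrow> 'g \<Rightarrow> 'g"
    and scaleV :: "complex \<Rightarrow> 'v::ab_group_add \<Rightarrow> 'v" and partV :: "bit \<Rightarrow> 'v set" +
  fixes act :: "'g \<Rightarrow> 'v \<Rightarrow> 'v"
  assumes act_linear_left: "Vector_Spaces.linear scaleG scaleV (\<lambda>x. act x v)"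
    and act_linear_right: "Vector_Spaces.linear scaleV scaleV (act x)"
    and act_part: "x \<in> partG i \<Longrightarrow> v \<in> partV j \<Longrightarrow> act x v \<in> partV (i + j)"
    and act_bracket: "x \<in> partG i \<Longrightarrow> y \<in> partG j \<Longrightarrow>
      act x (act y v) - scaleV (koszul_sign i j) (act y (act x v)) = act (bracket x y) v"

text \<open>Freeness of rank \<open>n\<close> for a module over a commutative ring, given by its scalar
  multiplication.\<close>

definition free_of_rank :: "('r::comm_ring_1 \<Rightarrow> 'v::ab_group_add \<Rightarrow> 'v) \<Rightarrow> nat \<Rightarrow> bool" where
  "free_of_rank scale n \<longleftrightarrow> module scale \<and>
    (\<exists>B. finite B \<and> card B = n \<and> \<not> module.dependent scale B \<and> module.span scale B = UNIV)"


section \<open>The Neveu-Schwarz type super-BMS\<open>\<^sub>3\<close> algebra\<close>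

text \<open>Half-integers are encoded by integers: \<open>Gi k\<close> is the index of the basis vector \<open>G\<^sub>r\<close> with
  \<open>r = k + 1/2\<close>.  The algebra itself is the free complex vector space on the indices.\<close>

datatype sbms_index = Li int | Wi int | Gi int | C1i | C2i

type_synonym sbms = "sbms_index \<Rightarrow>\<^sub>0 complex"

definition half :: "int \<Rightarrow> complex" where
  "half k = of_int k + 1/2"

definition sbms_scale :: "complex \<Rightarrow> sbms \<Rightarrow> sbms" where
  "sbms_scale c x = Poly_Mapping.map ((*) c) x"

fun index_parity :: "sbms_index \<Rightarrow> bit" where
  "index_parity (Gi k) = 1"
| "index_parity _ = 0"

definition sbms_part :: "bit \<Rightarrow> sbms set" where
  "sbms_part i = {x. \<forall>b \<in> Poly_Mapping.keys x. index_parity b = i}"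

abbreviation basis_vec :: "sbms_index \<Rightarrow> sbms" where
  "basis_vec b \<equiv> Poly_Mapping.single b 1"

text \<open>For \<open>r = k + 1/2\<close> and \<open>s = l + 1/2\<close>, the index \<open>r + s\<close> is \<open>k + l + 1\<close> and
  \<open>m + r\<close> is \<open>(m + k) + 1/2\<close>.\<close>

fun index_bracket :: "sbms_index \<Rightarrow> sbms_index \<Rightarrow> sbms" where
  "index_bracket (Li m) (Li n) =
     sbms_scale (of_int (n - m)) (basis_vec (Li (m + n)))
     + (if m + n = 0 then sbms_scale (of_int (n^3 - n) / 12) (basis_vec C1i) else 0)"
| "index_bracket (Li m) (Wi n) =
     sbms_scale (of_int (n - m)) (basis_vec (Wi (m + n)))
     + (if m + n = 0 then sbms_scale (of_int (n^3 - n) / 12) (basis_vec C2i) else 0)"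
| "index_bracket (Wi n) (Li m) =
     - (sbms_scale (of_int (n - m)) (basis_vec (Wi (m + n)))
        + (if m + n = 0 then sbms_scale (of_int (n^3 - n) / 12) (basis_vec C2i) else 0))"
| "index_bracket (Li m) (Gi k) =
     sbms_scale (half k - of_int m / 2) (basis_vec (Gi (m + k)))"
| "index_bracket (Gi k) (Li m) =
     - sbms_scale (half k - of_int m / 2) (basis_vec (Gi (m + k)))"
| "index_bracket (Gi k) (Gi l) =
     sbms_scale 2 (basis_vec (Wi (k + l + 1)))
     + (if k + l + 1 = 0 then sbms_scale (1/3 * ((half k)\<^sup>2 - 1/4)) (basis_vec C2i) else 0)"
| "index_bracket _ _ = 0"

definition sbms_bracket :: "sbms \<Rightarrow> sbms \<Rightarrow> sbms" where
  "sbms_bracket x y =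
     (\<Sum>a\<in>Poly_Mapping.keys x. \<Sum>b\<in>Poly_Mapping.keys y.
        sbms_scale (Poly_Mapping.lookup x a * Poly_Mapping.lookup y b) (index_bracket a b))"


section \<open>The module \<open>M\<close>\<close>

text \<open>Polynomials in two variables are iterated polynomials.  The inner variable, written \<open>tvar\<close>, is
  \<open>t\<close> (resp. \<open>y\<close>), the outer variable, written \<open>svar\<close>, is \<open>s\<close> (resp. \<open>x\<close>).  With the same type
  used for \<open>\<complex>[t,s]\<close> and \<open>\<complex>[y,x]\<close>, passing from \<open>f(t,s)\<close> to \<open>f(y,x - r)\<close> is just the
  translation of the outer variable.\<close>

type_synonym poly2 = "complex poly poly"

definition tvar :: poly2 where "tvar = [:[:0, 1:]:]"

definition svar :: poly2 where "svar = [:0, 1:]"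

definition const2 :: "complex \<Rightarrow> poly2" where "const2 c = [:[:c:]:]"

text \<open>\<open>shift c f\<close> is \<open>f(t, s - c)\<close>.\<close>

definition shift :: "complex \<Rightarrow> poly2 \<Rightarrow> poly2" where
  "shift c f = pcompose f (svar - const2 c)"

text \<open>\<open>dt\<close> is the partial derivative in the inner variable.\<close>

definition dt :: "poly2 \<Rightarrow> poly2" where
  "dt f = map_poly pderiv f"

text \<open>The polynomial \<open>h\<^sub>m\<close>; the division is exact.\<close>

definition hm :: "complex \<Rightarrow> complex poly \<Rightarrow> int \<Rightarrow> complex poly" where
  "hm \<alpha> h m = smult (of_int m) h
     - smult (of_int (m * (m - 1)) * \<alpha>) ((h - [:poly h \<alpha>:]) div [:- \<alpha>, 1:])"

text \<open>The even part of \<open>M\<close> is the first factor, the odd part the second.\<close>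

type_synonym M = "poly2 \<times> poly2"

definition M_scale :: "complex \<Rightarrow> M \<Rightarrow> M" where
  "M_scale c v = (const2 c * fst v, const2 c * snd v)"

definition M_part :: "bit \<Rightarrow> M set" where
  "M_part i = (if i = 0 then {(f, k) |f k. k = 0} else {(f, k) |f k. f = 0})"

text \<open>The parameter \<open>l\<close> is the \<open>\<lambda>\<close> of the paper.  For \<open>G\<^sub>r\<close> with \<open>r = j + 1/2\<close>, the exponents \<open>r - 1/2\<close> and \<open>r + 1/2\<close> of
  \<open>l\<close> are \<open>j\<close> and \<open>j + 1\<close>.\<close>

fun index_act :: "complex \<Rightarrow> complex \<Rightarrow> complex poly \<Rightarrow> sbms_index \<Rightarrow> M \<Rightarrow> M" where
  "index_act l \<alpha> h (Li m) (f, k) =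
     (const2 (l powi m) * (svar + [:hm \<alpha> h m:]) * shift (of_int m) f
        - const2 (of_int m * l powi m) * (tvar - const2 (of_int m * \<alpha>)) * dt (shift (of_int m) f),
      const2 (l powi m) * (svar - const2 (of_int m / 2) + [:hm \<alpha> h m:]) * shift (of_int m) k
        - const2 (of_int m * l powi m) * (tvar - const2 (of_int m * \<alpha>)) * dt (shift (of_int m) k))"
| "index_act l \<alpha> h (Wi m) (f, k) =
     (const2 (l powi m) * (tvar - const2 (of_int m * \<alpha>)) * shift (of_int m) f,
      const2 (l powi m) * (tvar - const2 (of_int m * \<alpha>)) * shift (of_int m) k)"
| "index_act l \<alpha> h (Gi j) (f, k) =
     (const2 (l powi (j + 1)) * (tvar - const2 (2 * half j * \<alpha>)) * shift (half j) k,
      const2 (l powi j) * shift (half j) f)"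
| "index_act l \<alpha> h C1i (f, k) = 0"
| "index_act l \<alpha> h C2i (f, k) = 0"

definition M_act :: "complex \<Rightarrow> complex \<Rightarrow> complex poly \<Rightarrow> sbms \<Rightarrow> M \<Rightarrow> M" where
  "M_act l \<alpha> h x v =
     (\<Sum>b\<in>Poly_Mapping.keys x. M_scale (Poly_Mapping.lookup x b) (index_act l \<alpha> h b v))"

text \<open>The enveloping algebra of the abelian subalgebra spanned by \<open>L\<^sub>0\<close> and \<open>W\<^sub>0\<close> is the
  polynomial ring \<open>\<complex>[L\<^sub>0, W\<^sub>0]\<close>, again an iterated one with inner variable \<open>W\<^sub>0\<close> and outer
  variable \<open>L\<^sub>0\<close>.  On a module, \<open>\<Sum> c\<^sub>i\<^sub>j L\<^sub>0\<^sup>i W\<^sub>0\<^sup>j\<close> acts through the operators of \<open>L\<^sub>0\<close>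
  and \<open>W\<^sub>0\<close>.\<close>

definition UT_act ::
  "(complex \<Rightarrow> 'v::ab_group_add \<Rightarrow> 'v) \<Rightarrow> (sbms \<Rightarrow> 'v \<Rightarrow> 'v) \<Rightarrow> poly2 \<Rightarrow> 'v \<Rightarrow> 'v" where
  "UT_act scale act p v =
     (\<Sum>i\<le>degree p. \<Sum>j\<le>degree (coeff p i).
        scale (coeff (coeff p i) j)
          ((act (basis_vec (Li 0)) ^^ i) ((act (basis_vec (Wi 0)) ^^ j) v)))"

end

theory Submission
  imports Defs
begin

text \<open>
  The bracket and the action are extended linearly from basis vectors (\<open>lin_ext\<close>), so the axioms
  of a Lie superalgebra and of a module over it hold as soon as they hold for basis vectors.

  For the bracket this is a finite case distinction on the kinds of basis vectors
  (\<open>index_bracket_skew\<close>, \<open>index_jacobi\<close>); its content is that the central coefficients are cocycles.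

  For the action, each basis vector acts on a component of \<open>M\<close> by multiplications, a translation
  \<open>shift c\<close> of the outer variable and the derivation \<open>dt\<close> in the inner one.  Translation is a ring
  endomorphism that commutes with \<open>dt\<close>, so a composite of two such operators expands into polynomial
  multiples of a translate of \<open>f\<close>, \<open>dt f\<close> and \<open>dt (dt f)\<close>, and each commutation relation becomes an
  identity of polynomial coefficients.  Two observations make these identities tractable.  Writing
  \<open>h = h(\<alpha>) + (t - \<alpha>) q\<close> gives \<open>h\<^sub>m = m (h(\<alpha>) + (t - m \<alpha>) q)\<close> without a division (\<open>hm_lift\<close>), which
  makes \<open>[L\<^sub>m, L\<^sub>n]\<close> a ring computation (\<open>L_L_commutator\<close>).  And the action of \<open>L\<^sub>m\<close> on the odd component is
  the one on the even component with \<open>h - 1/2\<close> in place of \<open>h\<close> (\<open>index_act_Li\<close>), so that the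
  relations among the \<open>L\<^sub>m\<close> and \<open>W\<^sub>m\<close> have to be verified on one component only.

  As \<open>h\<^sub>0 = 0\<close>, the elements \<open>L\<^sub>0\<close> and \<open>W\<^sub>0\<close> act as multiplication by the two variables.  Hence a
  polynomial in them acts on both components as multiplication by that polynomial (\<open>UT_act_M\<close>), and
  \<open>M\<close> is free on \<open>(1, 0)\<close> and \<open>(0, 1)\<close>.
\<close>

section \<open>Linear extension from basis vectors\<close>

lemma lookup_sbms_scale [simp]:
  "Poly_Mapping.lookup (sbms_scale c x) b = c * Poly_Mapping.lookup x b"
  by (simp add: sbms_scale_def map.rep_eq when_def)

locale complex_vector_space = vector_space scale
  for scale :: "complex \<Rightarrow> 'v::ab_group_add \<Rightarrow> 'v"

interpretation sbms: complex_vector_space sbms_scale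
  by unfold_locales (auto intro!: poly_mapping_eqI simp: lookup_add algebra_simps)

lemma sbms_eq_sum_basis:
  "x = (\<Sum>b\<in>Poly_Mapping.keys x. sbms_scale (Poly_Mapping.lookup x b) (basis_vec b))"
  by (intro poly_mapping_eqI)
     (simp add: lookup_sum lookup_single when_def in_keys_iff if_distrib sum.delta' cong: if_cong)

text \<open>Every multilinear identity on homogeneous elements reduces to basis vectors by this rule,
  applied to one argument after the other.\<close>

lemma sbms_part_induct [consumes 1, case_names basis zero add scale]:
  assumes "x \<in> sbms_part i"
    and "\<And>b. index_parity b = i \<Longrightarrow> P (basis_vec b)"
    and "P 0" and "\<And>x y. P x \<Longrightarrow> P y \<Longrightarrow> P (x + y)"
    and "\<And>c x. P x \<Longrightarrow> P (sbms_scale c x)"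
  shows "P x"
proof -
  have "P (\<Sum>b\<in>B. sbms_scale (Poly_Mapping.lookup x b) (basis_vec b))"
    if "B \<subseteq> Poly_Mapping.keys x" "finite B" for B
    using that(2,1)
    by (induction B rule: finite_induct) (use assms in \<open>auto simp: sbms_part_def\<close>)
  from this[of "Poly_Mapping.keys x"] show ?thesis
    using sbms_eq_sum_basis[of x] by simp
qed

text \<open>The bracket and the action are both sums over the keys of a finitely supported function;
  this is their common form, so that linearity needs a proof only once.\<close>

definition lin_ext ::
  "(complex \<Rightarrow> 'v \<Rightarrow> 'v::ab_group_add) \<Rightarrow> (sbms_index \<Rightarrow> 'v) \<Rightarrow> sbms \<Rightarrow> 'v" where
  "lin_ext scale \<phi> x =
     (\<Sum>b\<in>Poly_Mapping.keys x. scale (Poly_Mapping.lookup x b) (\<phi> b))"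

context complex_vector_space
begin

text \<open>Sums over the keys of \<open>x\<close>, \<open>y\<close> and \<open>x + y\<close> range over different sets; enlarging them to a common
  one makes them comparable.\<close>

lemma lin_ext_superset:
  assumes "finite B" "Poly_Mapping.keys x \<subseteq> B"
  shows "lin_ext scale \<phi> x = (\<Sum>b\<in>B. scale (Poly_Mapping.lookup x b) (\<phi> b))"
  unfolding lin_ext_def using assms by (intro sum.mono_neutral_left) (auto simp: in_keys_iff)

lemma lin_ext_linear: "Vector_Spaces.linear sbms_scale scale (lin_ext scale \<phi>)"
  unfolding Vector_Spaces.linear_iff
proof (intro conjI allI)
  show "vector_space sbms_scale" by (rule sbms.vector_space_axioms)
  show "vector_space scale" by (rule vector_space_axioms)
  fix x y :: sbms and c
  let ?B = "Poly_Mapping.keys x \<union> Poly_Mapping.keys y"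
  show "lin_ext scale \<phi> (x + y) = lin_ext scale \<phi> x + lin_ext scale \<phi> y"
    using lin_ext_superset[of ?B "x + y" \<phi>] lin_ext_superset[of ?B x \<phi>]
      lin_ext_superset[of ?B y \<phi>] keys_add[of x y]
    by (simp add: lookup_add scale_left_distrib sum.distrib)
  have "Poly_Mapping.keys (sbms_scale c x) \<subseteq> Poly_Mapping.keys x"
    by (auto simp: in_keys_iff)
  then show "lin_ext scale \<phi> (sbms_scale c x) = scale c (lin_ext scale \<phi> x)"
    using lin_ext_superset[of "Poly_Mapping.keys x" "sbms_scale c x" \<phi>]
    by (simp add: lin_ext_def scale_sum_right)
qed

lemma lin_ext_basis [simp]: "lin_ext scale \<phi> (basis_vec b) = \<phi> b"
  by (simp add: lin_ext_def)

lemma lin_ext_linear_parameter: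
  assumes "\<And>b. Vector_Spaces.linear s' scale (T b)"
  shows "Vector_Spaces.linear s' scale (\<lambda>v. lin_ext scale (\<lambda>b. T b v) x)"
proof -
  interpret s': vector_space s' using assms[THEN Vector_Spaces.linear.axioms(1)] .
  interpret P: vector_space_pair s' scale ..
  show ?thesis
    unfolding lin_ext_def
    by (intro P.linear_compose_sum ballI P.linear_compose_scale_right assms)
qed

lemma lin_ext_mem_subspace:
  assumes "subspace S" "\<And>b. b \<in> Poly_Mapping.keys x \<Longrightarrow> \<phi> b \<in> S"
  shows "lin_ext scale \<phi> x \<in> S"
  unfolding lin_ext_def using assms by (intro subspace_sum subspace_scale)

end

section \<open>The Lie superalgebra axioms\<close>

lemma basis_in_part: "basis_vec b \<in> sbms_part (index_parity b)"
  by (simp add: sbms_part_def)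

lemma subspace_sbms_part: "sbms.subspace (sbms_part i)"
  unfolding sbms.subspace_def sbms_part_def
  by (force simp: in_keys_iff lookup_add)

lemma bit_eq_0_or_1: "i = 0 \<or> i = (1::bit)" by (cases i) auto

lemma sbms_super_vector_space: "super_vector_space sbms_scale sbms_part"
proof
  show "sbms.subspace (sbms_part i)" for i by (rule subspace_sbms_part)
  show "\<exists>a\<in>sbms_part 0. \<exists>b\<in>sbms_part 1. v = a + b" for v
  proof -
    let ?c = "\<lambda>i. \<Sum>b | b \<in> Poly_Mapping.keys v \<and> index_parity b = i.
      sbms_scale (Poly_Mapping.lookup v b) (basis_vec b)"
    have part: "?c i \<in> sbms_part i" for i
      using subspace_sbms_part basis_in_part
      by (intro sbms.subspace_sum sbms.subspace_scale) auto
    have "v = (\<Sum>b\<in>Poly_Mapping.keys v. sbms_scale (Poly_Mapping.lookup v b) (basis_vec b))"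
      by (rule sbms_eq_sum_basis)
    also have "\<dots> = ?c 0 + ?c 1"
      by (subst sum.union_disjoint[symmetric]) (auto intro!: sum.cong simp: bit_eq_0_or_1)
    finally show ?thesis using part by blast
  qed
  show "sbms_part 0 \<inter> sbms_part 1 = {0}"
    by (force simp: sbms_part_def intro!: poly_mapping_eqI simp: in_keys_iff)
qed

lemma sbms_bracket_lin_ext:
  "sbms_bracket x y = lin_ext sbms_scale (\<lambda>a. lin_ext sbms_scale (index_bracket a) y) x"
  by (simp add: sbms_bracket_def lin_ext_def sbms.scale_sum_right)

lemma sbms_bracket_basis [simp]: "sbms_bracket (basis_vec a) (basis_vec b) = index_bracket a b"
  by (simp add: sbms_bracket_lin_ext)

lemma sbms_bracket_linear_left: "Vector_Spaces.linear sbms_scale sbms_scale (\<lambda>x. sbms_bracket x y)"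
  unfolding sbms_bracket_lin_ext by (rule sbms.lin_ext_linear)

lemma sbms_bracket_linear_right: "Vector_Spaces.linear sbms_scale sbms_scale (sbms_bracket x)"
  unfolding sbms_bracket_lin_ext[abs_def]
  by (intro sbms.lin_ext_linear_parameter sbms.lin_ext_linear)

interpretation sbms_left: Vector_Spaces.linear sbms_scale sbms_scale "\<lambda>x. sbms_bracket x y" for y
  by (rule sbms_bracket_linear_left)

interpretation sbms_right: Vector_Spaces.linear sbms_scale sbms_scale "sbms_bracket x" for x
  by (rule sbms_bracket_linear_right)

lemmas sbms_bracket_simps =
  sbms_left.add sbms_left.scale sbms_left.neg sbms_left.diff sbms_left.zero
  sbms_right.add sbms_right.scale sbms_right.neg sbms_right.diff sbms_right.zero

lemma index_bracket_part: "index_bracket a b \<in> sbms_part (index_parity a + index_parity b)"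
  by (cases a; cases b)
     (auto simp: sbms_part_def in_keys_iff lookup_add lookup_minus lookup_single when_def split: if_splits)

lemma scale_if: "(if P then sbms_scale c x else 0) = sbms_scale (if P then c else 0) x" by simp

text \<open>Only two cases have content.  In \<open>[L\<^sub>m, L\<^sub>n]\<close> the central coefficient is an odd function
  of \<open>n\<close>, and \<open>n = -m\<close> where it occurs.  In \<open>[G\<^sub>r, G\<^sub>s]\<close>, which is symmetric, it is an even
  function of \<open>s = -r\<close>.\<close>

lemma index_bracket_skew:
  "index_bracket a b =
    - sbms_scale (koszul_sign (index_parity a) (index_parity b)) (index_bracket b a)"
proof -
  have "half k ^ 2 = half j ^ 2" if "j + 1 = - k" for j k
  proof -
    from that have "j = - k - 1" by simp
    then have "half j = - half k" by (simp add: half_def)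
    then show ?thesis by simp
  qed
  then show ?thesis
    by (cases a; cases b; simp add: koszul_sign_def add.commute)
       (auto simp: algebra_simps add_eq_0_iff diff_divide_distrib simp flip: sbms.scale_minus_left)
qed


text \<open>Up to the order of the arguments, the iterated brackets are non-zero only for \<open>LLL\<close>, \<open>LLW\<close>,
  \<open>LLG\<close> and \<open>LGG\<close>.  The non-central parts agree as polynomials in the degrees.  The
  central parts occur in total degree 0 only and express that the coefficients \<open>(n\<^sup>3 - n)/12\<close> and
  \<open>(r\<^sup>2 - 1/4)/3\<close> define cocycles.\<close>

lemma index_jacobi:
  "sbms_bracket (basis_vec a) (index_bracket b c) =
    sbms_bracket (index_bracket a b) (basis_vec c) +
    sbms_scale (koszul_sign (index_parity a) (index_parity b))
      (sbms_bracket (basis_vec b) (index_bracket a c))"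
  (* Coordinates of the difference vanish away from the central index; at a central index the
     constraint that the three degrees add up to 0 eliminates one degree, and a polynomial
     identity in the other two remains. *)
  by (cases a; cases b; cases c)
     (simp_all add: sbms_bracket_simps koszul_sign_def scale_if
        del: of_int_add of_int_diff of_int_minus of_int_mult of_int_power,
      auto intro!: poly_mapping_eqI simp: lookup_add lookup_minus lookup_single when_def half_def,
      simp_all add: algebra_simps,
      simp_all flip: eq_neg_iff_add_eq_0,
      simp_all add: field_simps power2_eq_square power3_eq_cube)

lemma sbms_lie_superalgebra: "lie_superalgebra sbms_scale sbms_part sbms_bracket"
proof (intro lie_superalgebra.intro lie_superalgebra_axioms.intro sbms_super_vector_space
    sbms_bracket_linear_left sbms_bracket_linear_right)
  fix x y z :: sbms and i j k :: bit
  assume x: "x \<in> sbms_part i" and y: "y \<in> sbms_part j"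
  show "sbms_bracket x y \<in> sbms_part (i + j)"
    unfolding sbms_bracket_lin_ext
  proof (intro sbms.lin_ext_mem_subspace subspace_sbms_part)
    fix a b assume "a \<in> Poly_Mapping.keys x" "b \<in> Poly_Mapping.keys y"
    then have "index_parity a = i" "index_parity b = j" using x y by (auto simp: sbms_part_def)
    then show "index_bracket a b \<in> sbms_part (i + j)" using index_bracket_part[of a b] by simp
  qed
  show "sbms_bracket x y = - sbms_scale (koszul_sign i j) (sbms_bracket y x)"
    using x
  proof (induction x rule: sbms_part_induct)
    case (basis a)
    show ?case
      using y
    proof (induction y rule: sbms_part_induct)
      case (basis b)
      then show ?case using \<open>index_parity a = i\<close> index_bracket_skew[of a b] by simp
    qed (simp_all add: sbms_bracket_simps sbms.scale_right_distrib mult.commute del: sbms_bracket_basis)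
  qed (simp_all add: sbms_bracket_simps sbms.scale_right_distrib mult.commute)
  assume z: "z \<in> sbms_part k"
  show "sbms_bracket x (sbms_bracket y z) = sbms_bracket (sbms_bracket x y) z +
    sbms_scale (koszul_sign i j) (sbms_bracket y (sbms_bracket x z))"
    using x
  proof (induction x rule: sbms_part_induct)
    case (basis a)
    show ?case
      using y
    proof (induction y rule: sbms_part_induct)
      case (basis b)
      show ?case
        using z
      proof (induction z rule: sbms_part_induct)
        case (basis c)
        then show ?case
          using \<open>index_parity a = i\<close> \<open>index_parity b = j\<close> index_jacobi[of a b c] by simp
      qed (simp_all add: sbms_bracket_simps sbms.scale_right_distrib mult.commute del: sbms_bracket_basis)
    qed (simp_all add: sbms_bracket_simps sbms.scale_right_distrib mult.commute del: sbms_bracket_basis)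
  qed (simp_all add: sbms_bracket_simps sbms.scale_right_distrib mult.commute)
qed

section \<open>Translation and derivation on polynomials in two variables\<close>

lemma const2_simps:
  "const2 0 = 0" "const2 1 = 1" "const2 (a + b) = const2 a + const2 b"
  "const2 (a - b) = const2 a - const2 b" "const2 (- a) = - const2 a"
  "const2 (a * b) = const2 a * const2 b" "const2 (of_int m) = of_int m"
  by (simp_all add: const2_def of_int_poly one_pCons)

text \<open>A name for constants in the outer variable: the simplifier turns a literal product
  \<open>[:p:] * q\<close> into \<open>smult p q\<close>, which ring normalisation cannot see through.\<close>

definition inner :: "complex poly \<Rightarrow> poly2" where
  "inner p = [:p:]"

lemma const2_half_simps:
  "const2 2 = 2" "const2 (of_int m / 2) = of_int m * const2 (1/2)"
  "const2 (half j) = of_int j + const2 (1/2)" "2 * const2 (1/2) = 1"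
proof -
  show "const2 2 = 2" using const2_simps(7)[of 2] by simp
  show "const2 (of_int m / 2) = of_int m * const2 (1/2)"
    using const2_simps(6)[of "of_int m" "1/2"] by (simp add: const2_simps(7))
  show "const2 (half j) = of_int j + const2 (1/2)"
    by (simp add: half_def const2_simps)
  show "2 * const2 (1/2) = 1"
    using const2_simps(6)[of 2 "1/2"] \<open>const2 2 = 2\<close> by (simp add: const2_simps(2))
qed

lemma shift_simps:
  "shift c 0 = 0"
  "shift c (f + g) = shift c f + shift c g"
  "shift c (f - g) = shift c f - shift c g"
  "shift c (f * g) = shift c f * shift c g"
  "shift c (const2 a) = const2 a"
  "shift c tvar = tvar"
  "shift c (inner p) = inner p"
  "shift c svar = svar - const2 c"
  "shift c (of_int m) = of_int m"
  "shift c 1 = 1"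
  by (simp_all add: shift_def pcompose_add pcompose_diff pcompose_mult pcompose_1 inner_def
      const2_def tvar_def svar_def
      of_int_poly pcompose_pCons)

lemma shift_numeral: "shift c (numeral n) = numeral n"
  using shift_simps(9)[of c "numeral n"] by simp

lemma shift_shift: "shift a (shift b f) = shift (a + b) f"
proof -
  have "pcompose (svar - const2 b) (svar - const2 a) = svar - const2 (a + b)"
    by (simp add: svar_def const2_def pcompose_pCons)
  then show ?thesis by (simp add: shift_def flip: pcompose_assoc)
qed

lemma shift_0 [simp]: "shift 0 f = f"
  by (simp add: shift_def const2_def svar_def)

lemma coeff_dt: "coeff (dt f) n = pderiv (coeff f n)"
  by (simp add: dt_def coeff_map_poly)

lemma dt_linear_simps:
  "dt 0 = 0" "dt (f + g) = dt f + dt g" "dt (f - g) = dt f - dt g"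
  by (simp_all add: poly_eq_iff coeff_dt pderiv_add pderiv_diff )

lemma pderiv_sum: "pderiv (\<Sum>i\<in>A. f i) = (\<Sum>i\<in>A. pderiv (f i))"
  using higher_pderiv_sum[of 1 f A] by simp

lemma dt_mult: "dt (f * g) = dt f * g + f * dt g"
proof (rule poly_eqI)
  fix n
  have "coeff (dt (f * g)) n =
      (\<Sum>i\<le>n. pderiv (coeff f i) * coeff g (n - i) + coeff f i * pderiv (coeff g (n - i)))"
    by (simp add: coeff_dt coeff_mult pderiv_sum pderiv_mult algebra_simps)
  then show "coeff (dt (f * g)) n = coeff (dt f * g + f * dt g) n"
    by (simp add: coeff_dt coeff_mult sum.distrib)
qed

lemma dt_simps:
  "dt (inner p) = inner (pderiv p)" "dt (const2 a) = 0" "dt tvar = 1" "dt svar = 0" "dt (of_int m) = 0"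
  by (rule poly_eqI, simp add: coeff_dt inner_def const2_def tvar_def svar_def of_int_poly
       one_pCons coeff_pCons pderiv_pCons split: nat.split)+

lemma dt_numeral: "dt 1 = 0" "dt (numeral n) = 0"
  using dt_simps(5)[of 1] dt_simps(5)[of "numeral n"] by simp_all

text \<open>Derivation and translation concern different variables.  With this rule every composite of
  two operators becomes a combination of translates of \<open>f\<close>, \<open>dt f\<close> and \<open>dt (dt f)\<close>, and operator identities
  turn into identities between coefficients.\<close>

lemma dt_shift: "dt (shift c f) = shift c (dt f)"
proof (induction f)
  case 0
  then show ?case by (simp add: shift_simps dt_linear_simps)
next
  case (pCons a f)
  have "pCons a f = inner a + svar * f" for a :: "complex poly" and f by (simp add: svar_def inner_def)
  then show ?case
    using pCons by (simp add: shift_simps dt_linear_simps dt_mult dt_simps)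
qed

section \<open>Commutation of the operators\<close>

text \<open>These are the operators of \<open>L\<^sub>m\<close>, \<open>W\<^sub>m\<close> and \<open>G\<^sub>r\<close> on one component at a time.  \<open>L_op\<close> is written for the
  even component only, because its odd counterpart is \<open>L_op\<close> for \<open>h - 1/2\<close>.\<close>

definition L_op :: "complex \<Rightarrow> complex \<Rightarrow> complex poly \<Rightarrow> int \<Rightarrow> poly2 \<Rightarrow> poly2" where
  "L_op l \<alpha> h m f = const2 (l powi m) * (svar + inner (hm \<alpha> h m)) * shift (of_int m) f
     - const2 (of_int m * l powi m) * (tvar - const2 (of_int m * \<alpha>)) * dt (shift (of_int m) f)"

definition W_op :: "complex \<Rightarrow> complex \<Rightarrow> int \<Rightarrow> poly2 \<Rightarrow> poly2" where
  "W_op l \<alpha> m f = const2 (l powi m) * (tvar - const2 (of_int m * \<alpha>)) * shift (of_int m) f"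

definition G_even :: "complex \<Rightarrow> int \<Rightarrow> poly2 \<Rightarrow> poly2" where
  "G_even l j f = const2 (l powi j) * shift (half j) f"

definition G_odd :: "complex \<Rightarrow> complex \<Rightarrow> int \<Rightarrow> poly2 \<Rightarrow> poly2" where
  "G_odd l \<alpha> j k = const2 (l powi (j + 1)) * (tvar - const2 (2 * half j * \<alpha>)) * shift (half j) k"

text \<open>Write \<open>h = h(\<alpha>) + (t - \<alpha>) q\<close>.  Then \<open>m (t - \<alpha>) q - m (m - 1) \<alpha> q = m (t - m \<alpha>) q\<close>, so the
  division disappears from \<open>h\<^sub>m = m (h(\<alpha>) + (t - m \<alpha>) q)\<close>.\<close>

lemma hm_lift:
  "inner (hm \<alpha> h m) = of_int m * (const2 (poly h \<alpha>)
     + (tvar - of_int m * const2 \<alpha>) * inner ((h - [:poly h \<alpha>:]) div [:- \<alpha>, 1:]))"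
proof -
  define q where "q = (h - [:poly h \<alpha>:]) div [:- \<alpha>, 1:]"
  have "[:- \<alpha>, 1:] dvd h - [:poly h \<alpha>:]" by (simp flip: poly_eq_0_iff_dvd)
  then have "h = [:poly h \<alpha>:] + [:- \<alpha>, 1:] * q"
    unfolding q_def by (simp only: dvd_mult_div_cancel) simp
  then have "hm \<alpha> h m = smult (of_int m) ([:poly h \<alpha>:] + [:- \<alpha>, 1:] * q)
     - smult (of_int (m * (m - 1)) * \<alpha>) q"
    by (simp add: hm_def q_def)
  also have "\<dots> = smult (of_int m) ([:poly h \<alpha>:] + [:- (of_int m * \<alpha>), 1:] * q)"
    by (rule poly_eqI) (simp add: coeff_pCons algebra_simps split: nat.split)
  finally show ?thesis
    unfolding q_def[symmetric]
    by (simp add: inner_def tvar_def const2_def of_int_poly algebra_simps smult_diff_right)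
qed

text \<open>A constant shift of \<open>h\<close> leaves the quotient \<open>q\<close> alone, so it changes \<open>h\<^sub>m\<close> by \<open>m\<close> times that
  constant; this is the term \<open>-m/2\<close> of \<open>L\<^sub>m\<close> on the odd component.\<close>

lemma hm_minus_half: "hm \<alpha> (h - [:1/2:]) m = hm \<alpha> h m - [:of_int m / 2:]"
  proof -
  have "h - [:1/2:] - [:poly (h - [:1/2:]) \<alpha>:] = h - [:poly h \<alpha>:]" by simp
  then show ?thesis by (simp only: hm_def) (simp add: smult_diff_right)
qed

lemma hm_minus_half_lift:
  "inner (hm \<alpha> (h - [:1/2:]) m) = inner (hm \<alpha> h m) - const2 (of_int m / 2)"
  by (simp add: hm_minus_half const2_def inner_def)

lemma index_act_Li:
  "index_act l \<alpha> h (Li m) (f, k) = (L_op l \<alpha> h m f, L_op l \<alpha> (h - [:1/2:]) m k)"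
proof -
  have "svar - const2 (of_int m / 2) + inner (hm \<alpha> h m) = svar + inner (hm \<alpha> (h - [:1/2:]) m)"
    by (simp only: hm_minus_half_lift) simp
  then show ?thesis by (simp only: L_op_def index_act.simps inner_def)
qed

lemmas op_simps = const2_simps shift_simps shift_numeral shift_shift
  dt_linear_simps dt_mult dt_simps dt_numeral dt_shift

lemma of_int_plus_half: "of_int m + half j = half (m + j)" "half j + of_int m = half (m + j)"
  "half i + half j = of_int (i + j + 1)"
  by (simp_all add: half_def)

lemma W_W_commute: "W_op l \<alpha> m (W_op l \<alpha> n f) = W_op l \<alpha> n (W_op l \<alpha> m f)"
  by (simp add: W_op_def op_simps add.commute)

lemma W_G_even_commute: "W_op l \<alpha> m (G_even l j f) = G_even l j (W_op l \<alpha> m f)"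
  by (simp add: W_op_def G_even_def op_simps add.commute)

lemma W_G_odd_commute: "W_op l \<alpha> m (G_odd l \<alpha> j f) = G_odd l \<alpha> j (W_op l \<alpha> m f)"
  by (simp add: W_op_def G_odd_def op_simps add.commute)

context
  fixes l :: complex
  assumes l: "l \<noteq> 0"
begin

text \<open>The coefficient of \<open>dt (dt f)\<close> is symmetric in \<open>m\<close> and \<open>n\<close>, and that of \<open>dt f\<close> a direct
  expansion.  For the coefficient of \<open>f\<close> one needs
  \<open>n h\<^sub>n - m h\<^sub>m - m (t - m \<alpha>) h\<^sub>n' + n (t - n \<alpha>) h\<^sub>m' = (n - m) h\<^sub>m\<^sub>+\<^sub>n\<close>.
  This holds for \<open>h\<^sub>m = m (c + (t - m \<alpha>) q)\<close>: the terms with \<open>q'\<close> cancel, and the coefficients of \<open>c\<close> and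
  \<open>q\<close> agree as polynomials in \<open>m\<close>, \<open>n\<close>, \<open>t\<close> and \<open>\<alpha>\<close>.\<close>

lemma L_L_commutator:
  "L_op l \<alpha> h m (L_op l \<alpha> h n f) - L_op l \<alpha> h n (L_op l \<alpha> h m f)
     = of_int (n - m) * L_op l \<alpha> h (m + n) f"
  using l
  by (simp add: L_op_def hm_lift op_simps power_int_add add.commute)
     (simp add: algebra_simps)

lemma L_W_commutator:
  "L_op l \<alpha> h m (W_op l \<alpha> n f) - W_op l \<alpha> n (L_op l \<alpha> h m f) = of_int (n - m) * W_op l \<alpha> (m + n) f"
  using l
  by (simp add: L_op_def W_op_def op_simps power_int_add add.commute)
     (simp add: algebra_simps)

text \<open>The operator \<open>G\<^sub>r\<close> on the even component is a pure translation by \<open>r\<close>, which moves \<open>s\<close> to \<open>s - r\<close>;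
  the commutator is this \<open>r\<close> together with the \<open>-m/2\<close> by which \<open>L\<^sub>m\<close> differs on the two components.\<close>

lemma L_G_even_commutator:
  "L_op l \<alpha> (h - [:1/2:]) m (G_even l j f) - G_even l j (L_op l \<alpha> h m f)
     = const2 (half j - of_int m / 2) * G_even l (m + j) f"
  using l
  by (simp add: L_op_def G_even_def hm_minus_half_lift op_simps
      power_int_add of_int_plus_half const2_half_simps)
     (simp add: algebra_simps)

text \<open>Here \<open>L\<^sub>m\<close> also differentiates the factor \<open>t - 2 r \<alpha>\<close> of \<open>G\<^sub>r\<close>, and the coefficients match through
  \<open>(r + m/2) (t - 2 r \<alpha>) - m (t - m \<alpha>) = (r - m/2) (t - 2 (m + r) \<alpha>)\<close>.\<close>

lemma L_G_odd_commutator: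
  "L_op l \<alpha> h m (G_odd l \<alpha> j k) - G_odd l \<alpha> j (L_op l \<alpha> (h - [:1/2:]) m k)
     = const2 (half j - of_int m / 2) * G_odd l \<alpha> (m + j) k"
  by (simp add: l L_op_def G_odd_def hm_minus_half_lift op_simps
      power_int_add of_int_plus_half const2_half_simps)
     (use const2_half_simps(4) in algebra)

text \<open>The sum of the two factors is \<open>(t - 2 r \<alpha>) + (t - 2 s \<alpha>) = 2 (t - (r + s) \<alpha>)\<close>, the factor in
  \<open>2 W\<^sub>r\<^sub>+\<^sub>s\<close>.\<close>

lemma G_odd_G_even_anticommutator:
  "G_odd l \<alpha> i (G_even l j f) + G_odd l \<alpha> j (G_even l i f) = 2 * W_op l \<alpha> (i + j + 1) f"
  using l
  by (simp add: W_op_def G_odd_def G_even_def op_simps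
      power_int_add of_int_plus_half const2_half_simps)
     (simp add: algebra_simps)

lemma G_even_G_odd_anticommutator:
  "G_even l i (G_odd l \<alpha> j f) + G_even l j (G_odd l \<alpha> i f) = 2 * W_op l \<alpha> (i + j + 1) f"
  using l
  by (simp add: W_op_def G_odd_def G_even_def op_simps
      power_int_add of_int_plus_half const2_half_simps)
     (simp add: algebra_simps)

end

section \<open>The module relations\<close>

interpretation M: complex_vector_space M_scale
  by unfold_locales (simp_all add: M_scale_def const2_simps algebra_simps)

lemma M_super_vector_space: "super_vector_space M_scale M_part"
proof
  show "M.subspace (M_part i)" for i
    by (auto simp: M.subspace_def M_part_def M_scale_def zero_prod_def)
  show "\<exists>a\<in>M_part 0. \<exists>b\<in>M_part 1. v = a + b" for v
    by (rule bexI[of _ "(fst v, 0)"], rule bexI[of _ "(0, snd v)"]) (auto simp: M_part_def)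
  show "M_part 0 \<inter> M_part 1 = {0}"
    by (auto simp: M_part_def zero_prod_def)
qed

lemma index_act_simps:
  "index_act l \<alpha> h (Li m) v = (L_op l \<alpha> h m (fst v), L_op l \<alpha> (h - [:1/2:]) m (snd v))"
  "index_act l \<alpha> h (Wi m) v = (W_op l \<alpha> m (fst v), W_op l \<alpha> m (snd v))"
  "index_act l \<alpha> h (Gi j) v = (G_odd l \<alpha> j (snd v), G_even l j (fst v))"
  "index_act l \<alpha> h C1i v = 0" "index_act l \<alpha> h C2i v = 0"
  by (cases v; simp add: index_act_Li W_op_def G_odd_def G_even_def del: index_act.simps(1))+

lemma index_act_linear: "Vector_Spaces.linear M_scale M_scale (index_act l \<alpha> h b)"
proof -
  have "vector_space M_scale" by (rule M.vector_space_axioms)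
  then show ?thesis
    unfolding Vector_Spaces.linear_iff
    by (cases b) (auto simp: index_act_simps M_scale_def L_op_def W_op_def G_odd_def G_even_def
      op_simps zero_prod_def algebra_simps)
qed

lemma index_act_part:
  assumes "v \<in> M_part j"
  shows "index_act l \<alpha> h b v \<in> M_part (index_parity b + j)"
  using assms bit_eq_0_or_1[of j]
  by (cases b) (auto simp: index_act_simps M_part_def L_op_def W_op_def G_odd_def G_even_def op_simps
    zero_prod_def)

lemma M_act_lin_ext: "M_act l \<alpha> h x v = lin_ext M_scale (\<lambda>b. index_act l \<alpha> h b v) x"
  by (simp add: M_act_def lin_ext_def)

lemma M_act_basis [simp]: "M_act l \<alpha> h (basis_vec b) v = index_act l \<alpha> h b v"
  by (simp add: M_act_lin_ext)

lemma M_act_linear_left: "Vector_Spaces.linear sbms_scale M_scale (\<lambda>x. M_act l \<alpha> h x v)"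
  unfolding M_act_lin_ext by (rule M.lin_ext_linear)

lemma M_act_linear_right: "Vector_Spaces.linear M_scale M_scale (M_act l \<alpha> h x)"
  unfolding M_act_lin_ext[abs_def] by (intro M.lin_ext_linear_parameter index_act_linear)

interpretation act_left: Vector_Spaces.linear sbms_scale M_scale "\<lambda>x. M_act l \<alpha> h x v" for l \<alpha> h v
  by (rule M_act_linear_left)

interpretation act_right: Vector_Spaces.linear M_scale M_scale "M_act l \<alpha> h x" for l \<alpha> h x
  by (rule M_act_linear_right)

lemmas M_act_simps =
  act_left.add act_left.scale act_left.neg act_left.diff act_left.zero
  act_right.add act_right.scale act_right.neg act_right.diff act_right.zero

lemma M_act_part:
  assumes "x \<in> sbms_part i" "v \<in> M_part j"
  shows "M_act l \<alpha> h x v \<in> M_part (i + j)"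
proof -
  interpret super_vector_space M_scale M_part by (rule M_super_vector_space)
  show ?thesis
    unfolding M_act_lin_ext
  proof (intro M.lin_ext_mem_subspace subspace_part)
    fix b assume "b \<in> Poly_Mapping.keys x"
    then have "index_parity b = i" using assms(1) by (simp add: sbms_part_def)
    then show "index_act l \<alpha> h b v \<in> M_part (i + j)" using index_act_part[OF assms(2)] by blast
  qed
qed

text \<open>The central elements act by 0, so the cocycle terms of the bracket leave no trace and the
  relations are the commutators of the operators on each component.\<close>

lemma index_act_bracket:
  assumes "l \<noteq> 0"
  shows "index_act l \<alpha> h a (index_act l \<alpha> h b v)
      - M_scale (koszul_sign (index_parity a) (index_parity b)) (index_act l \<alpha> h b (index_act l \<alpha> h a v))
     = M_act l \<alpha> h (index_bracket a b) v"
proof -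
  have op_zero: "L_op l \<alpha> g m 0 = 0" "W_op l \<alpha> m 0 = 0" "G_even l j 0 = 0" "G_odd l \<alpha> j 0 = 0" for g m j
    by (simp_all add: L_op_def W_op_def G_even_def G_odd_def op_simps)
  note move_L_right = L_W_commutator[OF assms, unfolded diff_eq_eq]
    L_G_even_commutator[OF assms, unfolded diff_eq_eq] L_G_odd_commutator[OF assms, unfolded diff_eq_eq]
  show ?thesis
    by (cases a; cases b)
       (simp_all add: koszul_sign_def index_act_simps M_act_simps scale_if M_scale_def
         zero_prod_def const2_simps op_zero L_L_commutator[OF assms] move_L_right
         W_W_commute W_G_even_commute W_G_odd_commute
         G_odd_G_even_anticommutator[OF assms] G_even_G_odd_anticommutator[OF assms] const2_half_simps(1))
qed

lemma M_act_bracket: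
  assumes l: "l \<noteq> 0" and x: "x \<in> sbms_part i" and y: "y \<in> sbms_part j"
  shows "M_act l \<alpha> h x (M_act l \<alpha> h y v) - M_scale (koszul_sign i j) (M_act l \<alpha> h y (M_act l \<alpha> h x v))
     = M_act l \<alpha> h (sbms_bracket x y) v"
  using x
proof (induction x rule: sbms_part_induct)
  case (basis a)
  show ?case
    using y
  proof (induction y rule: sbms_part_induct)
    case (basis b)
    then show ?case using \<open>index_parity a = i\<close> index_act_bracket[OF l, of \<alpha> h a b v] by simp
  qed (auto simp: M_act_simps sbms_bracket_simps M.scale_right_distrib M.scale_right_diff_distrib
       algebra_simps simp del: M_act_basis)
qed (auto simp: M_act_simps sbms_bracket_simps M.scale_right_distrib M.scale_right_diff_distrib algebra_simps)

section \<open>Freeness\<close>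

text \<open>Since \<open>h\<^sub>0 = 0\<close>, the operators of \<open>L\<^sub>0\<close> and \<open>W\<^sub>0\<close> are multiplication by the two variables on each
  component.\<close>

lemma L0_W0_act:
  "M_act l \<alpha> h (basis_vec (Li 0)) v = (svar * fst v, svar * snd v)"
  "M_act l \<alpha> h (basis_vec (Wi 0)) v = (tvar * fst v, tvar * snd v)"
  by (simp_all add: index_act_simps L_op_def W_op_def hm_def inner_def const2_simps)

lemma funpow_mult_pair: "((\<lambda>v. (a * fst v, a * snd v)) ^^ n) (f, k) = (a ^ n * f, a ^ n * k :: 'a::comm_ring_1)"
  by (induction n) (simp_all add: mult.assoc)

lemma inner_sum: "inner (\<Sum>i\<in>A. f i) = (\<Sum>i\<in>A. inner (f i))"
proof -
  have "inner 0 = 0" "inner (p + q) = inner p + inner q" for p q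
    by (simp_all add: inner_def)
  then show ?thesis by (induction A rule: infinite_finite_induct) simp_all
qed

lemma poly2_expansion:
  "(\<Sum>i\<le>degree p. \<Sum>j\<le>degree (coeff p i). const2 (coeff (coeff p i) j) * svar ^ i * tvar ^ j) = p"
proof -
  have expand: "(\<Sum>j\<le>degree q. const2 (coeff q j) * tvar ^ j) = inner q" for q
  proof -
    have "tvar ^ j = inner (monom 1 j)" for j
      by (induction j) (simp_all add: tvar_def inner_def one_pCons monom_Suc)
    then have "(\<Sum>j\<le>degree q. const2 (coeff q j) * tvar ^ j) = (\<Sum>j\<le>degree q. inner (monom (coeff q j) j))"
      by (simp add: const2_def inner_def smult_monom)
    also have "\<dots> = inner (\<Sum>j\<le>degree q. monom (coeff q j) j)"
      by (simp add: inner_sum)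
    finally show ?thesis by (simp add: poly_as_sum_of_monoms)
  qed
  have "inner a * svar ^ i = monom a i" for a i
  proof (induction i)
    case 0
    show ?case by (simp add: inner_def monom_0)
  next
    case (Suc i)
    have "inner a * svar ^ Suc i = svar * (inner a * svar ^ i)" by (simp add: mult_ac)
    then show ?case by (simp only: Suc) (simp add: svar_def monom_Suc)
  qed
  then have "(\<Sum>i\<le>degree p. inner (coeff p i) * svar ^ i) = p"
    by (simp add: poly_as_sum_of_monoms)
  then show ?thesis
    by (simp add: sum_distrib_left mult_ac flip: expand)
qed

text \<open>Substituting the two variables for \<open>L\<^sub>0\<close> and \<open>W\<^sub>0\<close> in \<open>p\<close> gives back \<open>p\<close>.\<close>

lemma UT_act_M: "UT_act M_scale (M_act l \<alpha> h) p v = (p * fst v, p * snd v)"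
proof (cases v)
  case (Pair f k)
  have "UT_act M_scale (M_act l \<alpha> h) p v =
    (\<Sum>i\<le>degree p. \<Sum>j\<le>degree (coeff p i).
       (const2 (coeff (coeff p i) j) * svar ^ i * tvar ^ j * f,
        const2 (coeff (coeff p i) j) * svar ^ i * tvar ^ j * k))"
    unfolding UT_act_def L0_W0_act[abs_def] Pair
    by (simp add: funpow_mult_pair M_scale_def mult.assoc)
  also have "\<dots> = (p * f, p * k)"
    by (simp add: sum_prod flip: sum_distrib_right) (simp add: poly2_expansion)
  finally show ?thesis by (simp add: Pair)
qed

lemma UT_act_free: "free_of_rank (UT_act M_scale (M_act l \<alpha> h)) 2"
proof -
  let ?s = "UT_act M_scale (M_act l \<alpha> h)"
  interpret module ?s
    by unfold_locales (simp_all add: UT_act_M algebra_simps)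
  let ?B = "{(1, 0), (0, 1)} :: M set"
  have "span ?B = UNIV"
  proof -
    have "(f, k) \<in> span ?B" for f k
    proof -
      have "(f, k) = ?s f (1, 0) + ?s k (0, 1)" by (simp add: UT_act_M)
      also have "\<dots> \<in> span ?B" by (intro span_add span_scale span_base) auto
      finally show ?thesis .
    qed
    then show ?thesis by auto
  qed
  moreover have "independent ?B"
    by (auto simp: dependent_finite UT_act_M zero_prod_def)
  moreover have "finite ?B" "card ?B = 2" by simp_all
  ultimately show ?thesis
    unfolding free_of_rank_def using module_axioms by blast
qed

theorem proposition2p7:
  fixes l \<alpha> :: complex and h :: "complex poly"
  assumes "l \<noteq> 0"
  shows "lie_superalgebra_module sbms_scale sbms_part sbms_bracket M_scale M_part (M_act l \<alpha> h)
    \<and> free_of_rank (UT_act M_scale (M_act l \<alpha> h)) 2"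
proof
  show "lie_superalgebra_module sbms_scale sbms_part sbms_bracket M_scale M_part (M_act l \<alpha> h)"
    by (intro lie_superalgebra_module.intro lie_superalgebra_module_axioms.intro
        sbms_lie_superalgebra M_super_vector_space M_act_linear_left M_act_linear_right
        M_act_part M_act_bracket assms)
qed (rule UT_act_free)

end
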